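(* Let $A\subseteq\mathbb{Z}$ and let $\alpha>0$. (Upper Banach density version.) Suppose $\mathrm{BD}(A)=\alpha>0$, let $0\le\epsilon<\alpha^2$ be a real number, and let $k=\left\lfloor\frac{\alpha-\epsilon}{\alpha^2-\epsilon}\right\rfloor$. Then for every infinite $X\subseteq\mathbb{Z}$ and for every $x\in X$ there exists a finite subset $F\subset X$ such that: (1) $x\in F$; (2) $|F|\le k$; (3) $X\subseteq\Delta_\epsilon(A)+F$. In consequence, the set $\Delta_\epsilon(A)$ is syndetic, and its lower Banach density satisfies $\underline{\mathrm{BD}}(\Delta_\epsilon(A))\ge 1/k$. (Upper asymptotic density version.) Suppose $\overline{d}(A)=\alpha>0$, let $0\le\epsilon<\alpha^2$ be a real number, and let $k=\left\lfloor\frac{\alpha-\epsilon}{\alpha^2-\epsilon}\right\rfloor$. Then for every infinite $X\subseteq\mathbb{Z}$ and for every $x\in X$ there exists a finite subset $F\subset X$ such that: (1) $x\in F$; (2) $|F|\le k$; (3) $X\subseteq\overline{\Delta}_\epsilon(A)+F$. In consequence, the set $\overline{\Delta}_\epsilon(A)$ is syndetic, and $\underline{\mathrm{BD}}(\overline{\Delta}_\epsilon(A))\ge 1/k$.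
   Context: For $A\subseteq\mathbb{Z}$: the upper asymptotic density is $\overline{d}(A)=\limsup_{n\to\infty}|A\cap[1,n]|/n$. The upper Banach density is $\mathrm{BD}(A)=\lim_{n\to\infty}\max_{x\in\mathbb{Z}}\frac{|A\cap[x+1,x+n]|}{n}=\inf_{n\in\mathbb{N}}\max_{x\in\mathbb{Z}}\frac{|A\cap[x+1,x+n]|}{n}$. The lower Banach density is $\underline{\mathrm{BD}}(A)=\lim_{n\to\infty}\min_{x\in\mathbb{Z}}\frac{|A\cap[x+1,x+n]|}{n}=\sup_{n\in\mathbb{N}}\min_{x\in\mathbb{Z}}\frac{|A\cap[x+1,x+n]|}{n}$. Here $\mathbb{N}$ is the set of positive integers and intervals are intervals of integers. For real $\epsilon\ge0$: $\Delta_\epsilon(A)=\{t\in\mathbb{Z}\mid \mathrm{BD}(A\cap(A-t))>\epsilon\}$ and $\overline{\Delta}_\epsilon(A)=\{t\in\mathbb{Z}\mid \overline{d}(A\cap(A-t))>\epsilon\}$, where $A-t=\{a-t\mid a\in A\}$. Sumset: $A+F=\{a+f\mid a\in A, f\in F\}$. A set of integers is thick if it includes arbitrarily long finite intervals; it is syndetic if it has bounded gaps, i.e. its complement in $\mathbb{Z}$ is not thick (equivalently, $A+F=\mathbb{Z}$ for some finite $F$). *)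

theory Defs
  imports "HOL-Analysis.Analysis" "HOL-Library.Set_Algebras"
begin

text \<open>
  The quotients are in the interval from 0 to 1, so the limit superior, taken in the
  extended reals because the reals are not a complete lattice, is finite
  (lemma \<open>ereal_upper_density\<close>).  The term at \<open>n = 0\<close> is irrelevant for the limits below.
\<close>
definition upper_density :: "int set \<Rightarrow> real" where
  "upper_density A =
     real_of_ereal (limsup (\<lambda>n. ereal (real (card (A \<inter> {1..int n})) / real n)))"

text \<open>
  \<open>max_count A n\<close> and \<open>min_count A n\<close> are the extreme values of \<open>|A \<inter> [x+1,x+n]|\<close> over all
  integers \<open>x\<close>.  \<open>Max\<close> and \<open>Min\<close> are applied to finite nonempty sets
  (lemma \<open>finite_range_count\<close>).
\<close>
definition max_count :: "int set \<Rightarrow> nat \<Rightarrow> nat" where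
  "max_count A n = Max (range (\<lambda>x. card (A \<inter> {x + 1..x + int n})))"

definition min_count :: "int set \<Rightarrow> nat \<Rightarrow> nat" where
  "min_count A n = Min (range (\<lambda>x. card (A \<inter> {x + 1..x + int n})))"

text \<open>
  Both limits exist and are the infimum and the supremum over the positive \<open>n\<close>,
  respectively (lemmas \<open>upper_banach_density_limit\<close> and \<open>lower_banach_density_limit\<close>).
\<close>
definition upper_banach_density :: "int set \<Rightarrow> real" where
  "upper_banach_density A = lim (\<lambda>n. real (max_count A n) / real n)"

definition lower_banach_density :: "int set \<Rightarrow> real" where
  "lower_banach_density A = lim (\<lambda>n. real (min_count A n) / real n)"

definition translate_down :: "int set \<Rightarrow> int \<Rightarrow> int set" where
  "translate_down A t = (\<lambda>a. a - t) ` A"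

definition Delta_banach :: "real \<Rightarrow> int set \<Rightarrow> int set" where
  "Delta_banach \<epsilon> A = {t. upper_banach_density (A \<inter> translate_down A t) > \<epsilon>}"

definition Delta_upper :: "real \<Rightarrow> int set \<Rightarrow> int set" where
  "Delta_upper \<epsilon> A = {t. upper_density (A \<inter> translate_down A t) > \<epsilon>}"

definition thick :: "int set \<Rightarrow> bool" where
  "thick S \<longleftrightarrow> (\<forall>n::nat. \<exists>x. {x + 1..x + int n} \<subseteq> S)"

definition syndetic :: "int set \<Rightarrow> bool" where
  "syndetic S \<longleftrightarrow> \<not> thick (- S)"


lemma card_interval_le: "card (A \<inter> {x + 1..x + int n}) \<le> n"
proof -
  have "card (A \<inter> {x + 1..x + int n}) \<le> card {x + 1..x + int n}"
    by (intro card_mono) auto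
  then show ?thesis by simp
qed

lemma ereal_upper_density:
  "ereal (upper_density A) = limsup (\<lambda>n. ereal (real (card (A \<inter> {1..int n})) / real n))"
proof -
  let ?f = "\<lambda>n. ereal (real (card (A \<inter> {1..int n})) / real n)"
  have "card (A \<inter> {1..int n}) \<le> n" for n
    using card_interval_le[of A 0 n] by simp
  then have "?f n \<le> 1" for n
    by (simp add: divide_le_eq)
  then have "limsup ?f \<le> 1"
    by (intro Limsup_bounded) auto
  moreover have "0 \<le> liminf ?f"
    by (intro Liminf_bounded) auto
  then have "0 \<le> limsup ?f"
    using Liminf_le_Limsup[of sequentially ?f] by simp
  ultimately have "\<bar>limsup ?f\<bar> \<noteq> \<infinity>"
    by auto
  then show ?thesis
    unfolding upper_density_def by (simp add: ereal_real)
qed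

lemma finite_range_count: "finite (range (\<lambda>x. card (A \<inter> {x + 1..x + int n})))"
  by (rule finite_subset[of _ "{..n}"]) (auto simp: card_interval_le)

lemma count_le_max_count: "card (A \<inter> {x + 1..x + int n}) \<le> max_count A n"
  unfolding max_count_def by (intro Max_ge finite_range_count) auto

lemma max_count_attained: "\<exists>x. max_count A n = card (A \<inter> {x + 1..x + int n})"
  using Max_in[OF finite_range_count[of A n]] unfolding max_count_def by auto

lemma max_count_le: "max_count A n \<le> n"
  using max_count_attained[of A n] card_interval_le by metis

lemma max_count_add: "max_count A (m + n) \<le> max_count A m + max_count A n"
proof -
  obtain x where x: "max_count A (m + n) = card (A \<inter> {x + 1..x + int (m + n)})"
    using max_count_attained by blast
  have "A \<inter> {x + 1..x + int (m + n)} =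
      (A \<inter> {x + 1..x + int m}) \<union> (A \<inter> {(x + int m) + 1..(x + int m) + int n})"
    by auto
  then have "max_count A (m + n) \<le>
      card (A \<inter> {x + 1..x + int m}) + card (A \<inter> {(x + int m) + 1..(x + int m) + int n})"
    using x by (metis card_Un_le)
  also have "\<dots> \<le> max_count A m + max_count A n"
    by (intro add_mono count_le_max_count)
  finally show ?thesis .
qed

lemma max_count_mult: "max_count A (q * m) \<le> q * max_count A m"
proof (induction q)
  case 0
  then show ?case using max_count_le[of A 0] by simp
next
  case (Suc q)
  then show ?case using max_count_add[of A m "q * m"] by simp
qed

lemma max_count_tendsto:
  "(\<lambda>n. real (max_count A n) / real n) \<longlonglongrightarrow> (INF n\<in>{1..}. real (max_count A n) / real n)"
proof -
  let ?u = "\<lambda>n. real (max_count A n) / real n"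
  define L where "L = (INF n\<in>{1..}. ?u n)"
  have bdd: "bdd_below (?u ` {1..})"
    by (rule bdd_belowI[of _ 0]) auto
  have lower: "L \<le> ?u n" if "n \<ge> 1" for n
    unfolding L_def using that by (intro cINF_lower bdd) auto
  have "?u \<longlonglongrightarrow> L"
  proof (rule LIMSEQ_I)
    fix e :: real assume e: "0 < e"
    obtain m where m: "m \<ge> 1" "?u m < L + e / 2"
      using cINF_less_iff[OF _ bdd, of "L + e / 2"] e unfolding L_def by auto
    obtain N :: nat where N: "real m / (e / 2) < real N"
      using reals_Archimedean2 by blast
    have "norm (?u n - L) < e" if n: "n \<ge> max N 1" for n
    proof -
      have "max_count A n \<le> max_count A (n div m * m) + max_count A (n mod m)"
        using max_count_add[of A "n div m * m" "n mod m"] by simp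
      also have "\<dots> \<le> n div m * max_count A m + m"
        using max_count_mult[of A "n div m" m] max_count_le[of A "n mod m"]
          mod_less_divisor[of m n] m(1) by linarith
      finally have "real (max_count A n) \<le> real (n div m) * real (max_count A m) + real m"
        by (metis of_nat_add of_nat_le_iff of_nat_mult)
      also have "\<dots> \<le> (real n / real m) * real (max_count A m) + real m"
        by (intro add_right_mono mult_right_mono of_nat_div_le_of_nat) auto
      finally have "?u n \<le> ((real n / real m) * real (max_count A m) + real m) / real n"
        by (rule divide_right_mono) simp
      also have "\<dots> = ?u m + real m / real n"
        using n m(1) by (simp add: field_simps)
      also have "real m / real n < e / 2"
      proof -
        have "real m / (e / 2) < real n"
          using N n by linarith
        then show ?thesis
          using e n by (simp add: field_simps)
      qed
      finally have "?u n < L + e"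
        using m(2) by linarith
      moreover have "L \<le> ?u n"
        using n by (intro lower) auto
      ultimately show ?thesis
        by (simp add: abs_if)
    qed
    then show "\<exists>n0. \<forall>n\<ge>n0. norm (?u n - L) < e"
      by blast
  qed
  then show ?thesis
    unfolding L_def .
qed

lemma upper_banach_density_limit:
  "(\<lambda>n. real (max_count A n) / real n) \<longlonglongrightarrow> upper_banach_density A"
  "upper_banach_density A = (INF n\<in>{1..}. real (max_count A n) / real n)"
  using max_count_tendsto[of A] limI[OF max_count_tendsto[of A]]
  unfolding upper_banach_density_def by simp_all

lemma min_count_eq: "min_count A n = n - max_count (- A) n"
proof -
  have compl: "card (A \<inter> {x + 1..x + int n}) = n - card (- A \<inter> {x + 1..x + int n})" for x
  proof -
    have "A \<inter> {x + 1..x + int n} = {x + 1..x + int n} - (- A \<inter> {x + 1..x + int n})"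
      by auto
    then have "card (A \<inter> {x + 1..x + int n}) =
        card {x + 1..x + int n} - card (- A \<inter> {x + 1..x + int n})"
      by (simp add: card_Diff_subset)
    then show ?thesis by simp
  qed
  obtain x where x: "max_count (- A) n = card (- A \<inter> {x + 1..x + int n})"
    using max_count_attained by blast
  show ?thesis
    unfolding min_count_def
  proof (rule Min_eqI[OF finite_range_count])
    show "n - max_count (- A) n \<in> range (\<lambda>x. card (A \<inter> {x + 1..x + int n}))"
      unfolding x compl[symmetric] by blast
  next
    fix y assume "y \<in> range (\<lambda>x. card (A \<inter> {x + 1..x + int n}))"
    then show "n - max_count (- A) n \<le> y"
      using compl count_le_max_count[of "- A"] by (auto intro: diff_le_mono2)
  qed
qed

lemma min_count_quotient:
  assumes "n \<ge> 1"
  shows "real (min_count A n) / real n = 1 - real (max_count (- A) n) / real n"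
  using assms max_count_le[of "- A" n] by (simp add: min_count_eq of_nat_diff diff_divide_distrib)

lemma lower_banach_density_compl: "lower_banach_density A = 1 - upper_banach_density (- A)"
  and lower_banach_density_limit:
    "(\<lambda>n. real (min_count A n) / real n) \<longlonglongrightarrow> lower_banach_density A"
    "lower_banach_density A = (SUP n\<in>{1..}. real (min_count A n) / real n)"
proof -
  let ?u = "\<lambda>n. real (max_count (- A) n) / real n"
  let ?l = "\<lambda>n. real (min_count A n) / real n"
  have "(\<lambda>n. 1 - ?u n) \<longlonglongrightarrow> 1 - upper_banach_density (- A)"
    by (intro tendsto_intros upper_banach_density_limit)
  then have lim: "?l \<longlonglongrightarrow> 1 - upper_banach_density (- A)"
    by (rule Lim_transform_eventually)
      (auto intro!: eventually_sequentiallyI[of 1] simp: min_count_quotient)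
  show eq: "lower_banach_density A = 1 - upper_banach_density (- A)"
    unfolding lower_banach_density_def using lim by (rule limI)
  show "?l \<longlonglongrightarrow> lower_banach_density A"
    using lim eq by simp
  have bdd: "bdd_below (?u ` {1..})"
    by (rule bdd_belowI[of _ 0]) auto
  have bdd': "bdd_above (?l ` {1..})"
    by (rule bdd_aboveI[of _ 1]) (auto simp: min_count_quotient)
  have "(SUP n\<in>{1..}. ?l n) \<le> 1 - upper_banach_density (- A)"
  proof (rule cSUP_least)
    fix n :: nat assume n: "n \<in> {1..}"
    then have "upper_banach_density (- A) \<le> ?u n"
      unfolding upper_banach_density_limit(2) by (intro cINF_lower bdd)
    then show "?l n \<le> 1 - upper_banach_density (- A)"
      using n by (simp add: min_count_quotient)
  qed auto
  moreover have "1 - (SUP n\<in>{1..}. ?l n) \<le> upper_banach_density (- A)"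
    unfolding upper_banach_density_limit(2)
  proof (rule cINF_greatest)
    fix n :: nat assume n: "n \<in> {1..}"
    then have "?l n \<le> (SUP n\<in>{1..}. ?l n)"
      by (intro cSUP_upper bdd')
    then show "1 - (SUP n\<in>{1..}. ?l n) \<le> ?u n"
      using n min_count_quotient[of n A] by simp
  qed auto
  ultimately show "lower_banach_density A = (SUP n\<in>{1..}. ?l n)"
    using eq by simp
qed

end

theory Submission
  imports Defs
begin

text \<open>
  Call a finite set \<open>F\<close> of integers separated if no difference of two distinct elements of
  \<open>F\<close> lies in the set \<open>D\<close> of those \<open>t\<close> for which \<open>A \<inter> (A - t)\<close> has density greater than
  \<open>\<epsilon>\<close>.  The theorem comes from one inequality: a separated set with \<open>m\<close> elements satisfies
  \<open>m (\<alpha>\<^sup>2 - \<epsilon>) \<le> \<alpha> - \<epsilon>\<close>, that is, \<open>m \<le> k\<close>.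

  The reason is a second moment estimate (\<open>separated_card_bound\<close>).  Take a long interval in
  which \<open>A\<close> has relative density close to \<open>\<alpha>\<close>.  Each of the \<open>m\<close> translates \<open>A - s\<close>, \<open>s \<in> F\<close>,
  then also has relative density close to \<open>\<alpha>\<close>, because a translation by \<open>s\<close> changes
  counts by at most \<open>\<bar>s\<bar>\<close>.  Two different translates meet in a translate of
  \<open>A \<inter> (A - (t - s))\<close>, whose relative density is at most about \<open>\<epsilon>\<close>.  By the
  Cauchy-Schwarz inequality the mean of the number of translates that contain a point has a
  square at most the mean of its square, which gives \<open>(m\<alpha>)\<^sup>2 \<le> m\<alpha> + m(m - 1)\<epsilon>\<close> in the limit.

  Given \<open>X\<close> and \<open>x \<in> X\<close>, a separated subset \<open>F\<close> of \<open>X\<close> that contains \<open>x\<close> and has the greatest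
  possible size works: if \<open>y \<in> X\<close> lies outside \<open>F\<close>, then adding \<open>y\<close> destroys
  separatedness, so \<open>y - f \<in> D\<close> for some \<open>f \<in> F\<close>, as \<open>D\<close> is symmetric
  (\<open>maximal_separated_covers\<close>).  With \<open>X\<close> the set of all integers, at most \<open>k\<close> translates of \<open>D\<close>
  cover the integers, and counting in a long interval yields the bound on the lower
  Banach density (\<open>lower_banach_density_of_cover\<close>); positive lower Banach density
  implies syndeticity.

  The argument uses a density only through its invariance under translation and
  through a sequence of growing intervals that realizes the density of \<open>A\<close>, while no
  set exceeds its own density asymptotically along these intervals.  Both upper densities have
  such sequences, so \<open>covering_by_return_times\<close> treats them together.
\<close>

section \<open>Translates and relative densities in intervals\<close>

definition window_density :: "int set \<Rightarrow> int \<Rightarrow> nat \<Rightarrow> real" where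
  "window_density B x n = real (card (B \<inter> {x + 1..x + int n})) / real n"

lemma mem_translate_down: "z \<in> translate_down A t \<longleftrightarrow> z + t \<in> A"
  unfolding translate_down_def by force

lemma translate_down_translate_down:
  "translate_down (translate_down A s) t = translate_down A (s + t)"
  by (auto simp: mem_translate_down algebra_simps)

lemma translate_down_0: "translate_down A 0 = A"
  by (auto simp: mem_translate_down)

lemma translate_down_Int_translate_down:
  "translate_down A s \<inter> translate_down A t = translate_down (A \<inter> translate_down A (t - s)) s"
  by (auto simp: mem_translate_down algebra_simps)

lemma card_translate_down_Int:
  "card (translate_down B s \<inter> {x + 1..x + int n}) = card (B \<inter> {x + s + 1..x + s + int n})"
proof -
  have "translate_down B s \<inter> {x + 1..x + int n} =
      (\<lambda>a. a - s) ` (B \<inter> {x + s + 1..x + s + int n})"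
    unfolding translate_down_def by (force simp: image_iff)
  then show ?thesis
    by (simp add: card_image inj_on_def)
qed

lemma card_translate_down_le:
  "card (translate_down B s \<inter> {x + 1..x + int n}) \<le> card (B \<inter> {x + 1..x + int n}) + nat \<bar>s\<bar>"
proof -
  \<comment> \<open>the part of the translated interval that lies outside the original one\<close>
  define J where "J = (if s \<ge> 0 then {x + int n + 1..x + int n + s} else {x + s + 1..x})"
  have J: "finite J" "card J = nat \<bar>s\<bar>"
    unfolding J_def by auto
  have "B \<inter> {x + s + 1..x + s + int n} \<subseteq> (B \<inter> {x + 1..x + int n}) \<union> J"
    unfolding J_def by auto
  then have "card (B \<inter> {x + s + 1..x + s + int n}) \<le> card ((B \<inter> {x + 1..x + int n}) \<union> J)"
    using J by (intro card_mono) auto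
  also have "\<dots> \<le> card (B \<inter> {x + 1..x + int n}) + card J"
    by (rule card_Un_le)
  finally show ?thesis
    unfolding card_translate_down_Int J(2) .
qed

lemma window_density_translate_le:
  "window_density (translate_down B s) x n \<le> window_density B x n + real_of_int \<bar>s\<bar> / real n"
proof -
  have "real (card (translate_down B s \<inter> {x + 1..x + int n})) \<le>
      real (card (B \<inter> {x + 1..x + int n})) + real_of_int \<bar>s\<bar>"
    using card_translate_down_le[of B s x n] by linarith
  then show ?thesis
    unfolding window_density_def add_divide_distrib[symmetric] by (rule divide_right_mono) simp
qed

lemma window_density_translate:
  "\<bar>window_density (translate_down B s) x n - window_density B x n\<bar> \<le> real_of_int \<bar>s\<bar> / real n"
  using window_density_translate_le[of B s x n]
    window_density_translate_le[of "translate_down B s" "- s" x n]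
  by (simp add: translate_down_translate_down translate_down_0 abs_le_iff)

lemma const_over_tendsto_0:
  assumes "filterlim N at_top sequentially"
  shows "(\<lambda>n. c / real (N n)) \<longlonglongrightarrow> 0"
proof (rule real_tendsto_divide_at_top)
  show "LIM n sequentially. real (N n) :> at_top"
    by (rule filterlim_compose[OF filterlim_real_sequentially assms])
qed (rule tendsto_const)

lemma window_density_translate_tendsto:
  assumes N: "filterlim N at_top sequentially"
    and lim: "(\<lambda>n. window_density B (x n) (N n)) \<longlonglongrightarrow> \<beta>"
  shows "(\<lambda>n. window_density (translate_down B s) (x n) (N n)) \<longlonglongrightarrow> \<beta>"
proof -
  have "(\<lambda>n. window_density (translate_down B s) (x n) (N n) - window_density B (x n) (N n))
      \<longlonglongrightarrow> 0"
    by (rule Lim_null_comparison[OF _ const_over_tendsto_0[OF N, of "real_of_int \<bar>s\<bar>"]])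
      (simp only: real_norm_def window_density_translate always_eventually simp_thms)
  from tendsto_add[OF this lim] show ?thesis by simp
qed

section \<open>Separated sets are small\<close>

text \<open>
  The Cauchy-Schwarz inequality for the function that counts how many of the sets contain
  a given point of the interval.
\<close>
lemma sum_window_density_squared_le:
  assumes "finite F"
  shows "(\<Sum>s\<in>F. window_density (B s) x n)\<^sup>2 \<le>
    (\<Sum>s\<in>F. \<Sum>t\<in>F. window_density (B s \<inter> B t) x n)"
proof (cases "n = 0")
  case True
  then show ?thesis by (simp add: window_density_def)
next
  case False
  define I where "I = {x + 1..x + int n}"
  define w :: "int \<Rightarrow> real" where "w z = (\<Sum>s\<in>F. of_bool (z \<in> B s))" for z
  have fin: "finite I" and cI: "card I = n"
    unfolding I_def by auto
  have count: "real (card (C \<inter> I)) = (\<Sum>z\<in>I. of_bool (z \<in> C))" for C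
    using fin by (simp add: sum.If_cases of_bool_def Int_commute)
  have first: "(\<Sum>s\<in>F. real (card (B s \<inter> I))) = (\<Sum>z\<in>I. w z)"
    unfolding count w_def by (rule sum.swap)
  have "(\<Sum>s\<in>F. \<Sum>t\<in>F. real (card ((B s \<inter> B t) \<inter> I))) =
      (\<Sum>s\<in>F. \<Sum>z\<in>I. \<Sum>t\<in>F. of_bool (z \<in> B s) * of_bool (z \<in> B t))"
    unfolding count by (intro sum.cong refl, subst sum.swap) (simp add: of_bool_conj)
  also have "\<dots> = (\<Sum>z\<in>I. (w z)\<^sup>2)"
    unfolding w_def power2_eq_square sum_product by (rule sum.swap)
  finally have second:
    "(\<Sum>s\<in>F. \<Sum>t\<in>F. real (card ((B s \<inter> B t) \<inter> I))) = (\<Sum>z\<in>I. (w z)\<^sup>2)" .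
  have "(\<Sum>z\<in>I. w z)\<^sup>2 \<le> (\<Sum>z\<in>I. (w z)\<^sup>2) * real n"
    using sum_squared_le_sum_of_squares[of w I] cI by simp
  then have "(\<Sum>z\<in>I. w z)\<^sup>2 / (real n)\<^sup>2 \<le> (\<Sum>z\<in>I. (w z)\<^sup>2) / real n"
    using False by (simp add: field_simps power2_eq_square)
  then show ?thesis
    unfolding first[symmetric] second[symmetric] unfolding window_density_def I_def
    by (simp add: sum_divide_distrib[symmetric] power_divide)
qed

text \<open>
  In the double sum of the preceding inequality the \<open>m\<close> diagonal terms tend to \<open>\<alpha>\<close> and the
  \<open>m(m - 1)\<close> others are eventually less than any \<open>c > \<epsilon>\<close>.
\<close>
lemma separated_card_bound:
  fixes A F :: "int set" and \<alpha> \<epsilon> :: real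
  assumes N: "filterlim N at_top sequentially"
    and lim: "(\<lambda>n. window_density A (x n) (N n)) \<longlonglongrightarrow> \<alpha>"
    and F: "finite F" "F \<noteq> {}"
    and sep: "\<And>s t c. \<lbrakk>s \<in> F; t \<in> F; s \<noteq> t; \<epsilon> < c\<rbrakk> \<Longrightarrow>
      \<forall>\<^sub>F n in sequentially. window_density (A \<inter> translate_down A (t - s)) (x n) (N n) < c"
  shows "real (card F) * (\<alpha>\<^sup>2 - \<epsilon>) \<le> \<alpha> - \<epsilon>"
proof -
  define m where "m = real (card F)"
  have m: "m > 0"
    using F unfolding m_def by (simp add: card_gt_0_iff)
  define d where "d C n = window_density C (x n) (N n)" for C n
  define S where "S n = (\<Sum>s\<in>F. d (translate_down A s) n)" for n
  have "S \<longlonglongrightarrow> (\<Sum>s\<in>F. \<alpha>)"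
    unfolding S_def d_def by (intro tendsto_sum window_density_translate_tendsto[OF N lim])
  then have S: "S \<longlonglongrightarrow> m * \<alpha>"
    by (simp add: m_def)
  have bound: "m * \<alpha>\<^sup>2 - \<alpha> \<le> (m - 1) * c" if c: "\<epsilon> < c" for c
  proof -
    have pair: "\<forall>\<^sub>F n in sequentially. d (translate_down A s \<inter> translate_down A t) n \<le> c"
      if st: "s \<in> F" "t \<in> F" "s \<noteq> t" for s t
    proof -
      \<comment> \<open>half of the slack \<open>c - \<epsilon>\<close> absorbs the error of translating by \<open>s\<close>\<close>
      have "\<forall>\<^sub>F n in sequentially. d (A \<inter> translate_down A (t - s)) n < (\<epsilon> + c) / 2"
        unfolding d_def using c by (intro sep[OF st]) simp
      moreover have "\<forall>\<^sub>F n in sequentially. real_of_int \<bar>s\<bar> / real (N n) < (c - \<epsilon>) / 2"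
        using c by (intro order_tendstoD(2)[OF const_over_tendsto_0[OF N]]) simp
      ultimately show ?thesis
      proof eventually_elim
        case (elim n)
        have "d (translate_down A s \<inter> translate_down A t) n \<le>
            d (A \<inter> translate_down A (t - s)) n + real_of_int \<bar>s\<bar> / real (N n)"
          unfolding d_def translate_down_Int_translate_down by (rule window_density_translate_le)
        also have "\<dots> \<le> (\<epsilon> + c) / 2 + (c - \<epsilon>) / 2"
          using elim by linarith
        finally show ?case by (simp add: field_simps)
      qed
    qed
    have "\<forall>\<^sub>F n in sequentially. \<forall>s\<in>F. \<forall>t\<in>F. s \<noteq> t \<longrightarrow>
        d (translate_down A s \<inter> translate_down A t) n \<le> c"
    proof (intro eventually_ball_finite[OF F(1)] ballI)
      fix s t assume "s \<in> F" "t \<in> F"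
      then show "\<forall>\<^sub>F n in sequentially. s \<noteq> t \<longrightarrow>
          d (translate_down A s \<inter> translate_down A t) n \<le> c"
        using pair[of s t] by (cases "s = t") auto
    qed
    then have "\<forall>\<^sub>F n in sequentially. (S n)\<^sup>2 \<le> S n + m * ((m - 1) * c)"
    proof eventually_elim
      case (elim n)
      have "(S n)\<^sup>2 \<le> (\<Sum>s\<in>F. \<Sum>t\<in>F. d (translate_down A s \<inter> translate_down A t) n)"
        unfolding S_def d_def by (rule sum_window_density_squared_le[OF F(1)])
      also have "\<dots> \<le> (\<Sum>s\<in>F. d (translate_down A s) n + (m - 1) * c)"
      proof (rule sum_mono)
        fix s assume s: "s \<in> F"
        have "(\<Sum>t\<in>F - {s}. d (translate_down A s \<inter> translate_down A t) n) \<le>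
            (\<Sum>t\<in>F - {s}. c)"
          using elim s by (intro sum_mono) auto
        also have "\<dots> = (m - 1) * c"
          using F s m unfolding m_def by (simp add: card_Diff_singleton of_nat_diff Suc_le_eq)
        finally show "(\<Sum>t\<in>F. d (translate_down A s \<inter> translate_down A t) n) \<le>
            d (translate_down A s) n + (m - 1) * c"
          using F(1) s by (simp add: sum.remove[of F s])
      qed
      also have "\<dots> = S n + m * ((m - 1) * c)"
        by (simp add: sum.distrib S_def m_def)
      finally show ?case .
    qed
    then have "(m * \<alpha>)\<^sup>2 \<le> m * \<alpha> + m * ((m - 1) * c)"
      by (intro tendsto_le[OF sequentially_bot tendsto_add[OF S tendsto_const] tendsto_power[OF S]])
    then have "m * (m * \<alpha>\<^sup>2) \<le> m * (\<alpha> + (m - 1) * c)"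
      by (simp add: power2_eq_square algebra_simps)
    then show ?thesis
      using m by simp
  qed
  have "((\<lambda>c. (m - 1) * c) \<longlongrightarrow> (m - 1) * \<epsilon>) (at_right \<epsilon>)"
    by (intro tendsto_intros)
  moreover have "\<forall>\<^sub>F c in at_right \<epsilon>. m * \<alpha>\<^sup>2 - \<alpha> \<le> (m - 1) * c"
    using bound by (simp add: eventually_at_filter)
  ultimately have "m * \<alpha>\<^sup>2 - \<alpha> \<le> (m - 1) * \<epsilon>"
    by (rule tendsto_lowerbound) simp
  then show ?thesis
    unfolding m_def by (simp add: algebra_simps)
qed

section \<open>Covering by translates\<close>

text \<open>
  A bound on the size of all separated sets lets the maximal one be taken by cardinality.
  Membership of \<open>0\<close> in \<open>D\<close> covers the points of \<open>F\<close> itself; symmetry of \<open>D\<close> is what makes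
  the order in the differences irrelevant for the other points.
\<close>
lemma maximal_separated_covers:
  fixes D X :: "'a::ab_group_add set"
  assumes zero: "0 \<in> D" and sym: "\<And>t. t \<in> D \<Longrightarrow> - t \<in> D"
    and small: "\<And>F. \<lbrakk>finite F; F \<noteq> {}; \<And>s t. \<lbrakk>s \<in> F; t \<in> F; s \<noteq> t\<rbrakk> \<Longrightarrow> t - s \<notin> D\<rbrakk> \<Longrightarrow>
      card F \<le> k"
    and x: "x \<in> X"
  shows "\<exists>F. finite F \<and> F \<subseteq> X \<and> x \<in> F \<and> card F \<le> k \<and> X \<subseteq> D + F"
proof -
  define P where "P F \<longleftrightarrow> finite F \<and> F \<subseteq> X \<and> x \<in> F \<and>
    (\<forall>s\<in>F. \<forall>t\<in>F. s \<noteq> t \<longrightarrow> t - s \<notin> D)" for F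
  have P_card: "card F \<le> k" if "P F" for F
    using that small[of F] unfolding P_def by blast
  have "P {x}"
    using x unfolding P_def by simp
  then have "\<exists>F. P F \<and> (\<forall>G. P G \<longrightarrow> card G \<le> card F)"
    by (rule ex_has_greatest_nat[of P _ card "Suc k"]) (simp add: P_card less_Suc_eq_le)
  then obtain F where F: "P F" and max: "\<And>G. P G \<Longrightarrow> card G \<le> card F"
    by blast
  have "y \<in> D + F" if y: "y \<in> X" for y
  proof (cases "y \<in> F")
    case True
    then show ?thesis
      using set_plus_intro[OF zero True] by simp
  next
    case False
    have "\<not> P (insert y F)"
    proof
      assume "P (insert y F)"
      then have "card (insert y F) \<le> card F"
        by (rule max)
      then show False
        using F False unfolding P_def by simp
    qed
    have "\<exists>f\<in>F. y - f \<in> D \<or> f - y \<in> D"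
    proof (rule ccontr)
      assume "\<not> ?thesis"
      then have "P (insert y F)"
        using F y unfolding P_def by simp
      with \<open>\<not> P (insert y F)\<close> show False ..
    qed
    then obtain f where f: "f \<in> F" and "y - f \<in> D \<or> f - y \<in> D"
      by blast
    then have "y - f \<in> D"
      using sym[of "f - y"] by auto
    then show ?thesis
      using set_plus_intro[OF _ f, of "y - f"] by simp
  qed
  then have "X \<subseteq> D + F"
    by blast
  with F P_card[OF F] show ?thesis
    unfolding P_def by (intro exI[of _ F]) simp
qed

text \<open>
  An interval of length \<open>n\<close> is the union of its intersections with the translates of \<open>D\<close>,
  and each translate contributes \<open>|D \<inter> I|\<close> points up to a bounded error.
\<close>
lemma lower_banach_density_of_cover:
  assumes F: "finite F" "F \<noteq> {}" "card F \<le> k" and cover: "UNIV \<subseteq> D + F"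
  shows "lower_banach_density D \<ge> 1 / real k"
proof -
  define C where "C = (\<Sum>f\<in>F. nat \<bar>f\<bar>)"
  have k: "k > 0"
    using F by (metis card_gt_0_iff less_le_trans)
  have count: "n \<le> k * card (D \<inter> {x + 1..x + int n}) + C" for x n
  proof -
    let ?I = "{x + 1..x + int n}"
    have "z \<in> (\<Union>f\<in>F. translate_down D (- f))" for z
    proof -
      have "z \<in> D + F"
        using cover by blast
      then obtain a f where "a \<in> D" "f \<in> F" "z = a + f"
        by (rule set_plus_elim)
      then show ?thesis
        by (intro UN_I[of f]) (simp_all add: mem_translate_down)
    qed
    then have "?I = (\<Union>f\<in>F. translate_down D (- f) \<inter> ?I)"
      by blast
    then have "card ?I \<le> (\<Sum>f\<in>F. card (translate_down D (- f) \<inter> ?I))"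
      using card_UN_le[OF F(1), of "\<lambda>f. translate_down D (- f) \<inter> ?I"] by simp
    also have "\<dots> \<le> (\<Sum>f\<in>F. card (D \<inter> ?I) + nat \<bar>f\<bar>)"
      using card_translate_down_le[of D "- f" x n for f] by (intro sum_mono) simp
    also have "\<dots> = card F * card (D \<inter> ?I) + C"
      by (simp add: sum.distrib C_def)
    also have "\<dots> \<le> k * card (D \<inter> ?I) + C"
      using F(3) by simp
    finally show ?thesis by simp
  qed
  have "1 / real k - (real C / real k) / real n \<le> real (min_count D n) / real n"
    if n: "n \<ge> 1" for n
  proof -
    obtain x where "min_count D n = card (D \<inter> {x + 1..x + int n})"
      using Min_in[OF finite_range_count[of D n]] unfolding min_count_def by auto
    then have "real n \<le> real k * real (min_count D n) + real C"
      using count[of n x] by (metis of_nat_add of_nat_le_iff of_nat_mult)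
    then have "(real n - real C) / (real k * real n) \<le>
        (real k * real (min_count D n)) / (real k * real n)"
      by (intro divide_right_mono) auto
    then show ?thesis
      using n k by (simp add: diff_divide_distrib)
  qed
  then have "\<forall>\<^sub>F n in sequentially.
      1 / real k - (real C / real k) / real n \<le> real (min_count D n) / real n"
    by (rule eventually_sequentiallyI)
  moreover have "(\<lambda>n. 1 / real k - (real C / real k) / real n) \<longlonglongrightarrow> 1 / real k - 0"
    by (intro tendsto_diff tendsto_const const_over_tendsto_0 filterlim_ident)
  ultimately show ?thesis
    using tendsto_le[OF sequentially_bot lower_banach_density_limit(1)] by simp
qed

lemma syndetic_if_lower_banach_density_pos:
  assumes "lower_banach_density D > 0"
  shows "syndetic D"
proof (rule ccontr)
  assume "\<not> syndetic D"
  then have thick: "\<exists>x. {x + 1..x + int n} \<subseteq> - D" for n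
    unfolding syndetic_def thick_def by simp
  have "min_count D n = 0" for n
  proof -
    obtain x where "{x + 1..x + int n} \<subseteq> - D"
      using thick by blast
    then have "D \<inter> {x + 1..x + int n} = {}"
      by blast
    then have "card (D \<inter> {x + 1..x + int n}) = 0"
      by simp
    then have "min_count D n \<le> 0"
      using Min_le[OF finite_range_count[of D n] rangeI[of _ x]] unfolding min_count_def by linarith
    then show ?thesis by simp
  qed
  then show False
    using assms lower_banach_density_limit(1)[of D] by (simp add: LIMSEQ_const_iff)
qed

section \<open>Return times of a set of positive density\<close>

text \<open>
  The functional \<open>\<delta>\<close> stands for either of the two upper densities, and the intervals
  \<open>[x n + 1, x n + N n]\<close> realize the density of \<open>A\<close>.
\<close>
lemma covering_by_return_times:
  fixes \<delta> :: "int set \<Rightarrow> real" and A :: "int set" and \<epsilon> :: real and k :: int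
  defines "D \<equiv> {t. \<delta> (A \<inter> translate_down A t) > \<epsilon>}"
  assumes inv: "\<And>B s. \<delta> (translate_down B s) = \<delta> B"
    and N: "filterlim N at_top sequentially"
    and lim: "(\<lambda>n. window_density A (x n) (N n)) \<longlonglongrightarrow> \<delta> A"
    and upper: "\<And>B c. \<delta> B < c \<Longrightarrow> \<forall>\<^sub>F n in sequentially. window_density B (x n) (N n) < c"
    and \<alpha>: "\<delta> A = \<alpha>" "\<alpha> > 0" and \<epsilon>: "0 \<le> \<epsilon>" "\<epsilon> < \<alpha>\<^sup>2"
    and k: "k = \<lfloor>(\<alpha> - \<epsilon>) / (\<alpha>\<^sup>2 - \<epsilon>)\<rfloor>"
  shows "(\<forall>X::int set. infinite X \<longrightarrow>
          (\<forall>x\<in>X. \<exists>F. finite F \<and> F \<subset> X \<and> x \<in> F \<and> int (card F) \<le> k \<and> X \<subseteq> D + F)) \<and>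
        syndetic D \<and> lower_banach_density D \<ge> 1 / real_of_int k"
proof -
  have small: "card F \<le> nat k"
    if F: "finite F" "F \<noteq> {}" and sep: "\<And>s t. \<lbrakk>s \<in> F; t \<in> F; s \<noteq> t\<rbrakk> \<Longrightarrow> t - s \<notin> D" for F
  proof -
    have "real (card F) * (\<alpha>\<^sup>2 - \<epsilon>) \<le> \<alpha> - \<epsilon>"
    proof (rule separated_card_bound[OF N lim[unfolded \<alpha>(1)] F])
      fix s t c assume st: "s \<in> F" "t \<in> F" "s \<noteq> t" and c: "\<epsilon> < c"
      have "\<delta> (A \<inter> translate_down A (t - s)) < c"
        using sep[OF st] c unfolding D_def by simp
      then show "\<forall>\<^sub>F n in sequentially.
          window_density (A \<inter> translate_down A (t - s)) (x n) (N n) < c"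
        by (rule upper)
    qed
    then have "real_of_int (int (card F)) \<le> (\<alpha> - \<epsilon>) / (\<alpha>\<^sup>2 - \<epsilon>)"
      using \<epsilon> by (simp add: field_simps)
    then show ?thesis
      unfolding k le_floor_iff[symmetric] by linarith
  qed
  \<comment> \<open>\<open>0 \<in> D\<close> amounts to \<open>\<epsilon> < \<alpha>\<close>, which follows from \<open>\<epsilon> < \<alpha>\<^sup>2\<close> because \<open>\<alpha> \<le> 1\<close>\<close>
  have "\<alpha> \<le> 1"
  proof (rule tendsto_upperbound[OF lim[unfolded \<alpha>(1)]])
    show "\<forall>\<^sub>F n in sequentially. window_density A (x n) (N n) \<le> 1"
      unfolding window_density_def by (intro always_eventually) (simp add: divide_le_eq card_interval_le)
  qed simp
  then have "\<alpha>\<^sup>2 \<le> \<alpha>"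
    using \<alpha>(2) by (simp add: power2_eq_square)
  then have zero: "0 \<in> D"
    using \<epsilon> \<alpha>(1) unfolding D_def by (simp add: translate_down_0)
  have sym: "- t \<in> D" if "t \<in> D" for t
  proof -
    have "A \<inter> translate_down A (- t) = translate_down (A \<inter> translate_down A t) (- t)"
      using translate_down_Int_translate_down[of A "- t" 0] by (simp add: translate_down_0 Int_commute)
    then show ?thesis
      using that inv unfolding D_def by simp
  qed
  have "k > 0"
    using small[of "{0}"] by simp
  have cover: "\<exists>F. finite F \<and> F \<subseteq> X \<and> x \<in> F \<and> card F \<le> nat k \<and> X \<subseteq> D + F"
    if "x \<in> X" for X x
  proof (rule maximal_separated_covers[OF zero _ _ that])
    show "- t \<in> D" if "t \<in> D" for t
      using that by (rule sym)
    show "card F \<le> nat k"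
      if "finite F" "F \<noteq> {}" "\<And>s t. \<lbrakk>s \<in> F; t \<in> F; s \<noteq> t\<rbrakk> \<Longrightarrow> t - s \<notin> D" for F
      using that by (rule small)
  qed
  have part1: "\<exists>F. finite F \<and> F \<subset> X \<and> x \<in> F \<and> int (card F) \<le> k \<and> X \<subseteq> D + F"
    if X: "infinite X" and x: "x \<in> X" for X x
  proof -
    obtain F where F: "finite F" "F \<subseteq> X" "x \<in> F" "card F \<le> nat k" "X \<subseteq> D + F"
      using cover[OF x] by blast
    moreover have "F \<noteq> X"
      using F(1) X by blast
    ultimately show ?thesis
      using \<open>k > 0\<close> by (intro exI[of _ F]) auto
  qed
  obtain F where "finite F" "0 \<in> F" "card F \<le> nat k" "UNIV \<subseteq> D + F"
    using cover[OF UNIV_I] by blast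
  then have "lower_banach_density D \<ge> 1 / real (nat k)"
    by (intro lower_banach_density_of_cover[of F]) auto
  then have part3: "lower_banach_density D \<ge> 1 / real_of_int k"
    using \<open>k > 0\<close> by simp
  then have "lower_banach_density D > 0"
    using \<open>k > 0\<close> by (intro less_le_trans[OF _ part3]) simp
  then show ?thesis
    using part1 part3 syndetic_if_lower_banach_density_pos by blast
qed

section \<open>The two upper densities\<close>

lemma upper_banach_density_translate:
  "upper_banach_density (translate_down B s) = upper_banach_density B"
proof -
  have "range (\<lambda>x. card (translate_down B s \<inter> {x + 1..x + int n})) =
      range (\<lambda>x. card (B \<inter> {x + 1..x + int n}))" for n
  proof -
    have "range (\<lambda>x. card (translate_down B s \<inter> {x + 1..x + int n})) =
        (\<lambda>x. card (B \<inter> {x + 1..x + int n})) ` range (\<lambda>x. x + s)"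
      unfolding card_translate_down_Int image_image ..
    also have "range (\<lambda>x. x + s) = UNIV"
      by (rule surjI[of _ "\<lambda>x. x - s"]) simp
    finally show ?thesis .
  qed
  then show ?thesis
    unfolding upper_banach_density_def max_count_def by simp
qed

text \<open>
  Translation changes the relative densities in \<open>[1, n]\<close> by at most \<open>\<bar>s\<bar> / n\<close>, a null sequence.
  The reverse inequality comes from translating back.
\<close>
lemma upper_density_translate_le: "upper_density (translate_down B s) \<le> upper_density B"
proof -
  define e where "e n = ereal (real_of_int \<bar>s\<bar> / real n)" for n
  have "e \<longlonglongrightarrow> 0"
    unfolding e_def zero_ereal_def lim_ereal by (rule const_over_tendsto_0[OF filterlim_ident])
  have "ereal (upper_density (translate_down B s)) \<le>
      limsup (\<lambda>n. e n + ereal (window_density B 0 n))"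
    unfolding ereal_upper_density
  proof (intro Limsup_mono always_eventually allI)
    fix n
    show "ereal (real (card (translate_down B s \<inter> {1..int n})) / real n) \<le>
        e n + ereal (window_density B 0 n)"
      using window_density_translate_le[of B s 0 n]
      by (simp add: e_def window_density_def add.commute)
  qed
  also have "\<dots> = 0 + limsup (\<lambda>n. ereal (window_density B 0 n))"
    using ereal_limsup_lim_add[OF \<open>e \<longlonglongrightarrow> 0\<close>] by simp
  also have "\<dots> = ereal (upper_density B)"
    by (simp add: ereal_upper_density window_density_def)
  finally show ?thesis by simp
qed

lemma upper_density_translate: "upper_density (translate_down B s) = upper_density B"
  using upper_density_translate_le[of B s] upper_density_translate_le[of "translate_down B s" "- s"]
  by (simp add: translate_down_translate_down translate_down_0)

lemma eventually_window_density_less_if_banach: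
  assumes "upper_banach_density B < c"
  shows "\<forall>\<^sub>F n in sequentially. window_density B (x n) n < c"
  using order_tendstoD(2)[OF upper_banach_density_limit(1) assms]
proof eventually_elim
  case (elim n)
  have "window_density B (x n) n \<le> real (max_count B n) / real n"
    unfolding window_density_def by (intro divide_right_mono) (simp_all add: count_le_max_count)
  then show ?case using elim by simp
qed

lemma upper_banach_density_attained:
  obtains x where "(\<lambda>n. window_density A (x n) n) \<longlonglongrightarrow> upper_banach_density A"
proof -
  obtain x where "\<And>n. max_count A n = card (A \<inter> {x n + 1..x n + int n})"
    using max_count_attained[of A] by metis
  then show thesis
    using that[of x] upper_banach_density_limit(1)[of A] by (simp add: window_density_def)
qed

lemma eventually_window_density_less_if_upper:
  assumes "upper_density B < c"
  shows "\<forall>\<^sub>F n in sequentially. window_density B 0 n < c"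
proof -
  have "limsup (\<lambda>n. ereal (window_density B 0 n)) < ereal c"
    using assms ereal_upper_density[of B] by (simp add: window_density_def flip: less_ereal.simps(1))
  then show ?thesis
    using Limsup_lessD by fastforce
qed

lemma upper_density_attained:
  obtains r :: "nat \<Rightarrow> nat" where "strict_mono r"
    "(\<lambda>n. window_density A 0 (r n)) \<longlonglongrightarrow> upper_density A"
proof -
  let ?f = "\<lambda>n. ereal (window_density A 0 n)"
  have "limsup ?f = ereal (upper_density A)"
    by (simp add: ereal_upper_density window_density_def)
  then obtain r :: "nat \<Rightarrow> nat" where "strict_mono r" "(?f \<circ> r) \<longlonglongrightarrow> ereal (upper_density A)"
    using limsup_subseq_lim[of ?f] by auto
  then show thesis
    using that[of r] by (simp add: o_def)
qed

theorem theoremI: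
  fixes A :: "int set" and \<alpha> :: real
  assumes "\<alpha> > 0"
  shows
    "(\<forall>(\<epsilon>::real) (k::int).
        upper_banach_density A = \<alpha> \<longrightarrow> 0 \<le> \<epsilon> \<longrightarrow> \<epsilon> < \<alpha>\<^sup>2 \<longrightarrow>
        k = \<lfloor>(\<alpha> - \<epsilon>) / (\<alpha>\<^sup>2 - \<epsilon>)\<rfloor> \<longrightarrow>
        (\<forall>X::int set. infinite X \<longrightarrow>
          (\<forall>x\<in>X. \<exists>F. finite F \<and> F \<subset> X \<and> x \<in> F \<and> int (card F) \<le> k \<and>
            X \<subseteq> Delta_banach \<epsilon> A + F)) \<and>
        syndetic (Delta_banach \<epsilon> A) \<and>
        lower_banach_density (Delta_banach \<epsilon> A) \<ge> 1 / real_of_int k) \<and>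
     (\<forall>(\<epsilon>::real) (k::int).
        upper_density A = \<alpha> \<longrightarrow> 0 \<le> \<epsilon> \<longrightarrow> \<epsilon> < \<alpha>\<^sup>2 \<longrightarrow>
        k = \<lfloor>(\<alpha> - \<epsilon>) / (\<alpha>\<^sup>2 - \<epsilon>)\<rfloor> \<longrightarrow>
        (\<forall>X::int set. infinite X \<longrightarrow>
          (\<forall>x\<in>X. \<exists>F. finite F \<and> F \<subset> X \<and> x \<in> F \<and> int (card F) \<le> k \<and>
            X \<subseteq> Delta_upper \<epsilon> A + F)) \<and>
        syndetic (Delta_upper \<epsilon> A) \<and>
        lower_banach_density (Delta_upper \<epsilon> A) \<ge> 1 / real_of_int k)"
proof (intro conjI[where P = "\<forall>\<epsilon> k. P \<epsilon> k" for P] allI impI)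
  fix \<epsilon> :: real and k :: int
  assume *: "upper_banach_density A = \<alpha>" "0 \<le> \<epsilon>" "\<epsilon> < \<alpha>\<^sup>2" "k = \<lfloor>(\<alpha> - \<epsilon>) / (\<alpha>\<^sup>2 - \<epsilon>)\<rfloor>"
  obtain x where x: "(\<lambda>n. window_density A (x n) n) \<longlonglongrightarrow> upper_banach_density A"
    by (rule upper_banach_density_attained)
  show "(\<forall>X::int set. infinite X \<longrightarrow>
          (\<forall>x\<in>X. \<exists>F. finite F \<and> F \<subset> X \<and> x \<in> F \<and> int (card F) \<le> k \<and>
            X \<subseteq> Delta_banach \<epsilon> A + F)) \<and>
        syndetic (Delta_banach \<epsilon> A) \<and>
        lower_banach_density (Delta_banach \<epsilon> A) \<ge> 1 / real_of_int k"
    unfolding Delta_banach_def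
    by (rule covering_by_return_times[OF upper_banach_density_translate filterlim_ident x
          eventually_window_density_less_if_banach *(1) assms *(2-4)])
next
  fix \<epsilon> :: real and k :: int
  assume *: "upper_density A = \<alpha>" "0 \<le> \<epsilon>" "\<epsilon> < \<alpha>\<^sup>2" "k = \<lfloor>(\<alpha> - \<epsilon>) / (\<alpha>\<^sup>2 - \<epsilon>)\<rfloor>"
  obtain r where r: "strict_mono r" "(\<lambda>n. window_density A 0 (r n)) \<longlonglongrightarrow> upper_density A"
    by (rule upper_density_attained)
  have N: "filterlim r at_top sequentially"
    using r(1) by (rule filterlim_subseq)
  have upper: "\<forall>\<^sub>F n in sequentially. window_density B 0 (r n) < c" if "upper_density B < c" for B c
    using eventually_window_density_less_if_upper[OF that] N
    by (rule eventually_compose_filterlim)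
  show "(\<forall>X::int set. infinite X \<longrightarrow>
          (\<forall>x\<in>X. \<exists>F. finite F \<and> F \<subset> X \<and> x \<in> F \<and> int (card F) \<le> k \<and>
            X \<subseteq> Delta_upper \<epsilon> A + F)) \<and>
        syndetic (Delta_upper \<epsilon> A) \<and>
        lower_banach_density (Delta_upper \<epsilon> A) \<ge> 1 / real_of_int k"
    unfolding Delta_upper_def
    by (rule covering_by_return_times[OF upper_density_translate N r(2) upper *(1) assms *(2-4)])
qed

end
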